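(* Let $q\in[0,1]$, $R_q>0$, and let $\Theta^*\in\mathbb{B}_q(R_q)\subset\mathbb{R}^{k\times p}$. Let $X_1,\dots,X_N\in\mathbb{R}^{k\times p}$ and $\vec{\varepsilon}\in\mathbb{R}^N$, and let $\vec{y} = \mathfrak{X}(\Theta^* ) + \vec{\varepsilon}$, where $[\mathfrak{X}(\Theta)]_i = \operatorname{trace}(X_i^T\Theta)$. Let $\delta\ge 0$. Suppose that the regularization parameter $\lambda_N>0$ satisfies $\lambda_N \ge 2\,\|\mathfrak{X}^*(\vec{\varepsilon})\|_{\mathrm{op}}/N$ and that $\mathfrak{X}$ satisfies restricted strong convexity with parameter $\kappa(\mathfrak{X})\in(0,1]$ over the set $\mathcal{C}(R_q\lambda_N^{-q};\delta)$. Then any solution $$\widehat\Theta \in \arg\min_{\Theta\in\mathbb{R}^{k\times p}} \Big\{ \frac{1}{2N}\|\vec{y}-\mathfrak{X}(\Theta)\|_2^2 + \lambda_N \|\Theta\|_1\Big\}$$ satisfies $$\|\widehat\Theta-\Theta^*\|_F \le \max\left\{\delta,\ 32\sqrt{R_q}\left(\frac{\lambda_N}{\kappa(\mathfrak{X})}\right)^{1-q/2}\right\}.$$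
   Context: For a matrix $\Theta$, $\sigma_1(\Theta)\ge\sigma_2(\Theta)\ge\dots$ are its singular values, $\|\Theta\|_1$ denotes the nuclear norm (sum of singular values), $\|\Theta\|_{\mathrm{op}}$ the largest singular value, and $\|\Theta\|_F$ the Frobenius norm. The adjoint of $\mathfrak{X}:\mathbb{R}^{k\times p}\to\mathbb{R}^N$ is $\mathfrak{X}^*(\vec\varepsilon)=\sum_{i=1}^N \varepsilon_i X_i$. For $q\in[0,1]$ and $R_q>0$, $$\mathbb{B}_q(R_q)=\Big\{\Theta\in\mathbb{R}^{k\times p}:\ \sum_{i=1}^{\min\{k,p\}}\sigma_i(\Theta)^q\le R_q\Big\},$$ with the convention $0^0=0$, so that $\mathbb{B}_0(R_0)$ is the set of matrices of rank at most $R_0$. Fix a singular value decomposition of $\Theta^*$ with singular values in non-increasing order. For an integer $0\le r\le\min\{k,p\}$, $U^r\in\mathbb{R}^{k\times r}$ and $V^r\in\mathbb{R}^{p\times r}$ are the matrices with orthonormal columns consisting of the top $r$ left and right singular vectors of $\Theta^*$. For matrices $U\in\mathbb{R}^{k\times r}$, $V\in\mathbb{R}^{p\times r}$ with orthonormal columns, $\mathcal{M}^\perp(U,V)$ is the subspace of matrices $\Theta\in\mathbb{R}^{k\times p}$ whose row space is orthogonal to the column span of $V$ and whose column space is orthogonal to the column span of $U$; $\Pi_{\mathcal{M}^\perp(U,V)}$ is the orthogonal projection onto it, i.e. $\Theta\mapsto (I-UU^T)\Theta(I-VV^T)$ (the identity map when $r=0$). For $\Delta\in\mathbb{R}^{k\times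 p}$ write $\Delta''=\Pi_{\mathcal{M}^\perp(U^r,V^r)}(\Delta)$ and $\Delta'=\Delta-\Delta''$. Define $$\mathcal{C}(r;\delta)=\Big\{\Delta\in\mathbb{R}^{k\times p}\ :\ \|\Delta\|_F\ge\delta,\ \|\Delta''\|_1\le 3\|\Delta'\|_1+4\|\Pi_{\mathcal{M}^\perp(U^r,V^r)}(\Theta^* )\|_1\Big\}.$$ For a real number $s\ge0$, $\mathcal{C}(s;\delta)$ means $\mathcal{C}(r;\delta)$ with $r=\min\{\lfloor s\rfloor,k,p\}$. The operator $\mathfrak{X}$ satisfies restricted strong convexity (RSC) with parameter $\kappa(\mathfrak{X})>0$ over a set $\mathcal{C}$ if $\frac{1}{2N}\|\mathfrak{X}(\Delta)\|_2^2\ge\kappa(\mathfrak{X})\|\Delta\|_F^2$ for all $\Delta\in\mathcal{C}$. *)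

theory Defs
  imports "HOL-Analysis.Analysis"
begin

text \<open>
  A $k \times p$ real matrix has type \<^typ>\<open>real^'p^'k\<close>. On this type the library's \<^term>\<open>norm\<close> is the
  Frobenius norm (the Euclidean norm of the vector of row norms) and the inner product is
  $\mathrm{trace}(A^T B)$; on \<^typ>\<open>real^'n\<close>, \<^term>\<open>norm\<close> is the Euclidean norm.
  Singular values and singular vectors are numbered from 0, so $\sigma_1$ is \<open>sing_val A 0\<close>.
\<close>

section \<open>Singular values\<close>

definition outer :: "real^'k \<Rightarrow> real^'p \<Rightarrow> real^'p^'k" where
  "outer u v = (\<chi> i j. u $ i * v $ j)"

definition orthonormal_family :: "nat \<Rightarrow> (nat \<Rightarrow> 'a::real_inner) \<Rightarrow> bool" where
  "orthonormal_family n U \<longleftrightarrow> (\<forall>i<n. \<forall>j<n. U i \<bullet> U j = (if i = j then 1 else 0))"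

definition min_dim :: "real^'p^'k \<Rightarrow> nat" where
  "min_dim (A :: real^'p^'k) = min CARD('k) CARD('p)"

definition is_svd ::
  "real^'p^'k \<Rightarrow> (nat \<Rightarrow> real^'k) \<Rightarrow> (nat \<Rightarrow> real) \<Rightarrow> (nat \<Rightarrow> real^'p) \<Rightarrow> bool" where
  "is_svd A U s V \<longleftrightarrow>
     orthonormal_family (min_dim A) U \<and>
     orthonormal_family (min_dim A) V \<and>
     (\<forall>i<min_dim A. 0 \<le> s i) \<and>
     (\<forall>i j. i \<le> j \<and> j < min_dim A \<longrightarrow> s j \<le> s i) \<and>
     A = (\<Sum>i<min_dim A. s i *\<^sub>R outer (U i) (V i))"

text \<open>Existence and uniqueness are proved below (\<open>ex1_sing_val\<close>).\<close>

definition sing_val :: "real^'p^'k \<Rightarrow> nat \<Rightarrow> real" where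
  "sing_val A = (THE s. (\<exists>U V. is_svd A U s V) \<and> (\<forall>i\<ge>min_dim A. s i = 0))"

lemma outer_mult_vec: "outer u v *v x = (v \<bullet> x) *\<^sub>R u"
  by (simp add: vec_eq_iff outer_def matrix_vector_mult_def inner_vec_def sum_distrib_left mult_ac)

lemma vec_mult_outer: "x v* outer u v = (x \<bullet> u) *\<^sub>R v"
  by (simp add: vec_eq_iff outer_def vector_matrix_mult_def inner_vec_def sum_distrib_left mult_ac)

lemma sum_mat_vec:
  fixes f :: "'i \<Rightarrow> real^'p^'k"
  shows "(\<Sum>i\<in>I. f i) *v x = (\<Sum>i\<in>I. f i *v x)"
  by (induction I rule: infinite_finite_induct) (auto simp: matrix_vector_mult_add_rdistrib)

lemma orthonormal_familyD:
  "orthonormal_family n U \<Longrightarrow> i < n \<Longrightarrow> j < n \<Longrightarrow> U i \<bullet> U j = (if i = j then 1 else 0)"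
  by (simp add: orthonormal_family_def)

lemma orthonormal_family_inj:
  assumes "orthonormal_family n U" shows "inj_on U {..<n}"
proof
  fix i j assume "i \<in> {..<n}" "j \<in> {..<n}" "U i = U j"
  then show "i = j" using orthonormal_familyD[OF assms, of i j] orthonormal_familyD[OF assms, of i i]
    by (auto split: if_splits)
qed

lemma orthonormal_family_dim:
  fixes U :: "nat \<Rightarrow> 'a::euclidean_space"
  assumes "orthonormal_family n U" shows "dim (U ` {..<n}) = n"
proof -
  have "pairwise orthogonal (U ` {..<n})"
    using orthonormal_familyD[OF assms]
    by (auto simp: pairwise_def orthogonal_def)
  moreover have "0 \<notin> U ` {..<n}" using orthonormal_familyD[OF assms] by force
  ultimately have "independent (U ` {..<n})" by (rule pairwise_orthogonal_independent)
  then show ?thesis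
    using orthonormal_family_inj[OF assms] by (simp add: dim_eq_card_independent card_image)
qed

lemma orthonormal_family_extend:
  fixes U :: "nat \<Rightarrow> 'a::euclidean_space"
  assumes "n < DIM('a)"
  obtains x where "norm x = 1" "\<And>i. i < n \<Longrightarrow> U i \<bullet> x = 0"
proof -
  have "dim (U ` {..<n}) < DIM('a)"
    using assms dim_le_card'[of "U ` {..<n}"] card_image_le[of "{..<n}" U] by simp
  then obtain x where x: "x \<noteq> 0" "\<And>y. y \<in> span (U ` {..<n}) \<Longrightarrow> orthogonal x y"
    using orthogonal_to_subspace_exists by blast
  then have "U i \<bullet> x = 0" if "i < n" for i
    using x(2)[OF span_base, of "U i"] that by (simp add: orthogonal_def inner_commute)
  with x(1) show ?thesis by (intro that[of "x /\<^sub>R norm x"]) auto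
qed

lemma orthonormal_family_Suc:
  assumes "orthonormal_family n U" "norm x = 1" "\<And>i. i < n \<Longrightarrow> U i \<bullet> x = 0"
  shows "orthonormal_family (Suc n) (U(n := x))"
  using assms by (auto simp: orthonormal_family_def less_Suc_eq inner_commute norm_eq_1)

lemma norm_residual:
  assumes "norm u = 1" "u \<bullet> a = t"
  shows "(norm (a - t *\<^sub>R u))\<^sup>2 = (norm a)\<^sup>2 - t\<^sup>2"
proof -
  have "(a - t *\<^sub>R u) \<bullet> (a - t *\<^sub>R u) = a \<bullet> a - 2 * t * (u \<bullet> a) + t * t * (u \<bullet> u)"
    by (simp add: inner_diff_left inner_diff_right inner_commute)
  then show ?thesis
    using assms by (simp add: dot_square_norm power2_eq_square)
qed

text \<open>Greedy construction of singular triples: the next pair maximises $x^T A y$ over unit vectors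
  orthogonal to the pairs found so far.\<close>

lemma svd_greedy:
  fixes A :: "real^'p^'k"
  assumes "n \<le> min_dim A"
  shows "\<exists>U s V. orthonormal_family n U \<and> orthonormal_family n V \<and> (\<forall>i<n. 0 \<le> s i) \<and>
     (\<forall>i j. i \<le> j \<and> j < n \<longrightarrow> s j \<le> s i) \<and>
     (\<forall>i<n. A *v V i = s i *\<^sub>R U i \<and> U i v* A = s i *\<^sub>R V i) \<and>
     (\<forall>x y. norm x = 1 \<longrightarrow> norm y = 1 \<longrightarrow> (\<forall>i<n. U i \<bullet> x = 0 \<and> V i \<bullet> y = 0) \<longrightarrow>
        (\<forall>i<n. x \<bullet> (A *v y) \<le> s i))"
  using assms
proof (induction n)
  case 0
  then show ?case by (auto simp: orthonormal_family_def)
next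
  case (Suc n)
  then have "n \<le> min_dim A" by simp
  from Suc.IH[OF this] obtain U s V where
    U: "orthonormal_family n U" and V: "orthonormal_family n V" and s0: "\<forall>i<n. 0 \<le> s i" and
    mono: "\<forall>i j. i \<le> j \<and> j < n \<longrightarrow> s j \<le> s i" and
    sing: "\<forall>i<n. A *v V i = s i *\<^sub>R U i \<and> U i v* A = s i *\<^sub>R V i" and
    mx: "\<forall>x y. norm x = 1 \<longrightarrow> norm y = 1 \<longrightarrow> (\<forall>i<n. U i \<bullet> x = 0 \<and> V i \<bullet> y = 0) \<longrightarrow>
        (\<forall>i<n. x \<bullet> (A *v y) \<le> s i)"
    by (elim exE conjE) (rule that)
  have AV: "A *v V i = s i *\<^sub>R U i" and UA: "U i v* A = s i *\<^sub>R V i" if "i < n" for i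
    using sing that by auto
  have nk: "n < CARD('k)" "n < CARD('p)" using Suc.prems by (auto simp: min_dim_def)
  define X where "X = {x. norm x = 1 \<and> (\<forall>i<n. U i \<bullet> x = 0)}"
  define Y where "Y = {y. norm y = 1 \<and> (\<forall>i<n. V i \<bullet> y = 0)}"
  have Xeq: "X = sphere 0 1 \<inter> (\<Inter>i<n. {x. U i \<bullet> x = 0})" and Yeq: "Y = sphere 0 1 \<inter> (\<Inter>i<n. {x. V i \<bullet> x = 0})"
    by (auto simp: X_def Y_def)
  have "compact X" "compact Y" unfolding Xeq Yeq
    by (intro compact_Int_closed compact_sphere closed_INT ballI closed_hyperplane)+
  then have "compact (X \<times> Y)" by (rule compact_Times)
  moreover have "X \<times> Y \<noteq> {}"
  proof -
    obtain x where "norm x = 1" "\<And>i. i < n \<Longrightarrow> U i \<bullet> x = 0"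
      using orthonormal_family_extend[of n U] nk by auto
    moreover obtain y where "norm y = 1" "\<And>i. i < n \<Longrightarrow> V i \<bullet> y = 0"
      using orthonormal_family_extend[of n V] nk by auto
    ultimately have "(x, y) \<in> X \<times> Y" by (simp add: X_def Y_def)
    then show ?thesis by blast
  qed
  moreover have "continuous_on (X \<times> Y) (\<lambda>z. fst z \<bullet> (A *v snd z))"
    by (intro continuous_intros continuous_on_compose2[OF matrix_vector_mult_linear_continuous_on]) auto
  ultimately obtain z where z: "z \<in> X \<times> Y"
    and zmax: "\<forall>z'\<in>X \<times> Y. fst z' \<bullet> (A *v snd z') \<le> fst z \<bullet> (A *v snd z)"
    using continuous_attains_sup by blast
  obtain u v where uv: "z = (u, v)" by force
  define t where "t = u \<bullet> (A *v v)"
  have u: "norm u = 1" "\<And>i. i < n \<Longrightarrow> U i \<bullet> u = 0" and v: "norm v = 1" "\<And>i. i < n \<Longrightarrow> V i \<bullet> v = 0"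
    using z uv by (auto simp: X_def Y_def)
  have tmax: "x \<bullet> (A *v y) \<le> t" if "x \<in> X" "y \<in> Y" for x y
    using zmax that uv unfolding t_def by force
  have "- u \<in> X" using u by (auto simp: X_def)
  then have t0: "0 \<le> t" using tmax[of "-u" v] z uv by (auto simp: t_def)
  have tn: "x \<bullet> (A *v y) \<le> t * (norm x * norm y)"
    if "\<And>i. i < n \<Longrightarrow> U i \<bullet> x = 0" "\<And>i. i < n \<Longrightarrow> V i \<bullet> y = 0" for x y
  proof (cases "x = 0 \<or> y = 0")
    case False
    then have "x /\<^sub>R norm x \<in> X" "y /\<^sub>R norm y \<in> Y" using that by (auto simp: X_def Y_def)
    from tmax[OF this] False show ?thesis
      by (auto simp: matrix_vector_mult_scaleR field_simps)
  qed auto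
  have Av: "A *v v = t *\<^sub>R u"
  proof -
    have orth: "U i \<bullet> (A *v v) = 0" if "i < n" for i
      using that v by (simp add: dot_lmul_matrix[symmetric] UA)
    have "(A *v v) \<bullet> (A *v v) \<le> t * (norm (A *v v) * norm v)" by (rule tn) (auto simp: orth v)
    then have "norm (A *v v) \<le> t"
      using v t0 by (cases "A *v v = 0") (auto simp: power2_norm_eq_inner[symmetric] power2_eq_square)
    then have "(norm (A *v v))\<^sup>2 \<le> t\<^sup>2" by (simp add: power_mono)
    moreover have "(norm (A *v v - t *\<^sub>R u))\<^sup>2 = (norm (A *v v))\<^sup>2 - t\<^sup>2"
      using u(1) by (rule norm_residual) (simp add: t_def)
    ultimately have "(norm (A *v v - t *\<^sub>R u))\<^sup>2 \<le> 0" by simp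
    then show ?thesis by simp
  qed
  have uA: "u v* A = t *\<^sub>R v"
  proof -
    have orth: "V i \<bullet> (u v* A) = 0" if "i < n" for i
      using that u(2)[of i] AV[of i] by (subst inner_commute) (simp add: dot_lmul_matrix inner_commute[of u])
    have "u \<bullet> (A *v (u v* A)) \<le> t * (norm u * norm (u v* A))" by (rule tn) (auto simp: orth u)
    then have "norm (u v* A) \<le> t"
      using u t0 by (cases "u v* A = 0")
        (auto simp: dot_lmul_matrix[symmetric] power2_norm_eq_inner[symmetric] power2_eq_square)
    then have "(norm (u v* A))\<^sup>2 \<le> t\<^sup>2" by (simp add: power_mono)
    moreover have "v \<bullet> (u v* A) = t" by (subst inner_commute) (simp add: t_def dot_lmul_matrix)
    then have "(norm (u v* A - t *\<^sub>R v))\<^sup>2 = (norm (u v* A))\<^sup>2 - t\<^sup>2"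
      by (rule norm_residual[OF v(1)])
    ultimately have "(norm (u v* A - t *\<^sub>R v))\<^sup>2 \<le> 0" by simp
    then show ?thesis by simp
  qed
  have ts: "t \<le> s i" if "i < n" for i
    using mx[rule_format, of u v i] that u v by (auto simp: t_def)
  show ?case
  proof (intro exI conjI)
    show "orthonormal_family (Suc n) (U(n := u))" "orthonormal_family (Suc n) (V(n := v))"
      using U V u v by (auto intro!: orthonormal_family_Suc)
    show "\<forall>i<Suc n. 0 \<le> (s(n := t)) i" using s0 t0 by (auto simp: less_Suc_eq)
    show "\<forall>i j. i \<le> j \<and> j < Suc n \<longrightarrow> (s(n := t)) j \<le> (s(n := t)) i"
      using mono ts by (auto simp: less_Suc_eq)
    show "\<forall>i<Suc n. A *v (V(n := v)) i = (s(n := t)) i *\<^sub>R (U(n := u)) i \<and>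
        (U(n := u)) i v* A = (s(n := t)) i *\<^sub>R (V(n := v)) i"
      using AV UA Av uA by (auto simp: less_Suc_eq)
    show "\<forall>x y. norm x = 1 \<longrightarrow> norm y = 1 \<longrightarrow>
        (\<forall>i<Suc n. (U(n := u)) i \<bullet> x = 0 \<and> (V(n := v)) i \<bullet> y = 0) \<longrightarrow>
        (\<forall>i<Suc n. x \<bullet> (A *v y) \<le> (s(n := t)) i)"
    proof (intro allI impI)
      fix x y i
      assume xy: "norm x = 1" "norm y = 1"
        "\<forall>i<Suc n. (U(n := u)) i \<bullet> x = 0 \<and> (V(n := v)) i \<bullet> y = 0" and i: "i < Suc n"
      then have "\<And>i. i < n \<Longrightarrow> U i \<bullet> x = 0 \<and> V i \<bullet> y = 0"
        by (metis fun_upd_apply less_Suc_eq nat_neq_iff)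
      then have "x \<in> X" "y \<in> Y" using xy by (auto simp: X_def Y_def)
      then show "x \<bullet> (A *v y) \<le> (s(n := t)) i"
        using tmax[of x y] ts[of i] i by (auto simp: less_Suc_eq)
    qed
  qed
qed

lemma orthonormal_family_inner_sum:
  assumes "orthonormal_family n U" "j < n"
  shows "U j \<bullet> (\<Sum>i<n. c i *\<^sub>R U i) = c j"
proof -
  have "U j \<bullet> (\<Sum>i<n. c i *\<^sub>R U i) = (\<Sum>i<n. if i = j then c i else 0)"
    unfolding inner_sum_right using orthonormal_familyD[OF assms] by (intro sum.cong) auto
  then show ?thesis using assms(2) by simp
qed

lemma orthonormal_expand:
  fixes U :: "nat \<Rightarrow> 'a::euclidean_space"
  assumes U: "orthonormal_family n U" and n: "n = DIM('a)"
  shows "(\<Sum>i<n. (U i \<bullet> x) *\<^sub>R U i) = x"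
proof -
  define y where "y = (\<Sum>i<n. (U i \<bullet> x) *\<^sub>R U i) - x"
  have "U j \<bullet> y = 0" if "j < n" for j
    using that by (simp add: y_def inner_diff_right orthonormal_family_inner_sum[OF U])
  then have "\<forall>z \<in> U ` {..<n}. orthogonal y z" by (auto simp: orthogonal_def inner_commute)
  then have "orthogonal y z" if "z \<in> span (U ` {..<n})" for z
    using that by (metis orthogonal_to_span)
  moreover have "span (U ` {..<n}) = UNIV"
    using orthonormal_family_dim[OF U] n by (simp add: dim_eq_full)
  ultimately have "orthogonal y y" by auto
  then show ?thesis by (simp add: y_def orthogonal_self)
qed

lemma svd_exists:
  fixes A :: "real^'p^'k"
  shows "\<exists>U s V. is_svd A U s V"
proof -
  let ?m = "min_dim A"
  obtain U s V where
    U: "orthonormal_family ?m U" and V: "orthonormal_family ?m V" and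
    s: "\<forall>i<?m. 0 \<le> s i" "\<forall>i j. i \<le> j \<and> j < ?m \<longrightarrow> s j \<le> s i" and
    AV: "\<And>i. i < ?m \<Longrightarrow> A *v V i = s i *\<^sub>R U i" and
    UA: "\<And>i. i < ?m \<Longrightarrow> U i v* A = s i *\<^sub>R V i"
    using svd_greedy[of ?m A] by blast
  let ?B = "\<Sum>i<?m. s i *\<^sub>R outer (U i) (V i)"
  have B: "?B *v x = (\<Sum>i<?m. (s i * (V i \<bullet> x)) *\<^sub>R U i)" for x
    by (simp add: sum_mat_vec scaleR_matrix_vector_assoc[symmetric] outer_mult_vec)
  have "A *v x = ?B *v x" for x
  proof (cases "?m = CARD('k)")
    case True
    then have "A *v x = (\<Sum>i<?m. (U i \<bullet> (A *v x)) *\<^sub>R U i)"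
      by (intro orthonormal_expand[OF U, symmetric]) simp
    also have "\<dots> = ?B *v x"
      unfolding B by (intro sum.cong) (auto simp: dot_lmul_matrix[symmetric] UA)
    finally show ?thesis .
  next
    case False
    then have "?m = CARD('p)" by (auto simp: min_dim_def min_def split: if_splits)
    then have "A *v x = A *v (\<Sum>i<?m. (V i \<bullet> x) *\<^sub>R V i)"
      by (subst orthonormal_expand[OF V]) auto
    also have "\<dots> = (\<Sum>i<?m. A *v ((V i \<bullet> x) *\<^sub>R V i))"
      by (rule linear_sum[OF matrix_vector_mul_linear])
    also have "\<dots> = ?B *v x"
      unfolding B by (intro sum.cong) (auto simp: AV matrix_vector_mult_scaleR mult_ac)
    finally show ?thesis .
  qed
  then have "A = ?B" by (simp add: matrix_eq)
  with U V s show ?thesis unfolding is_svd_def by blast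
qed

lemma norm_orthonormal_sum:
  assumes "orthonormal_family n U"
  shows "(norm (\<Sum>i<n. c i *\<^sub>R U i))\<^sup>2 = (\<Sum>i<n. (c i)\<^sup>2)"
  unfolding power2_norm_eq_inner inner_sum_left
  by (intro sum.cong) (auto simp: orthonormal_family_inner_sum[OF assms] power2_eq_square)

lemma bessel:
  assumes U: "orthonormal_family n U"
  shows "(\<Sum>i<n. (U i \<bullet> x)\<^sup>2) \<le> (norm x)\<^sup>2"
proof -
  let ?y = "\<Sum>i<n. (U i \<bullet> x) *\<^sub>R U i"
  have "x \<bullet> ?y = (\<Sum>i<n. (U i \<bullet> x)\<^sup>2)"
    by (simp add: inner_sum_right inner_commute power2_eq_square)
  moreover have "(norm (x - ?y))\<^sup>2 = (norm x)\<^sup>2 - 2 * (x \<bullet> ?y) + (norm ?y)\<^sup>2"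
    by (simp add: power2_norm_eq_inner algebra_simps inner_commute)
  ultimately show ?thesis
    using norm_orthonormal_sum[OF U, of "\<lambda>i. U i \<bullet> x"] zero_le_power2[of "norm (x - ?y)"] by linarith
qed

lemma is_svd_norm:
  assumes svd: "is_svd A U s V"
  shows "(norm (A *v x))\<^sup>2 = (\<Sum>i<min_dim A. (s i)\<^sup>2 * (V i \<bullet> x)\<^sup>2)"
proof -
  define m where "m = min_dim A"
  have A: "A = (\<Sum>i<m. s i *\<^sub>R outer (U i) (V i))" and U: "orthonormal_family m U"
    using svd unfolding is_svd_def m_def by blast+
  have "A *v x = (\<Sum>i<m. (s i * (V i \<bullet> x)) *\<^sub>R U i)"
    by (subst A) (simp add: sum_mat_vec scaleR_matrix_vector_assoc[symmetric] outer_mult_vec)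
  then show ?thesis
    by (simp add: norm_orthonormal_sum[OF U] power_mult_distrib m_def[symmetric])
qed

lemma is_svd_le:
  fixes A :: "real^'p^'k"
  assumes 1: "is_svd A U s V" and 2: "is_svd A U' s' V'" and i: "i < min_dim A"
  shows "s' i \<le> s i"
proof -
  let ?m = "min_dim A" and ?T = "span (V' ` {..<Suc i})" and ?S = "span (V ` {..<i})"
  let ?P = "{y \<in> (UNIV :: (real^'p) set). \<forall>x \<in> ?S. orthogonal x y}"
  have V: "orthonormal_family ?m V" and V': "orthonormal_family ?m V'"
    using 1 2 unfolding is_svd_def by blast+
  have "orthonormal_family i V" "orthonormal_family (Suc i) V'"
    using V V' i by (auto simp: orthonormal_family_def)
  then have "dim ?S = i" "dim ?T = Suc i" by (simp_all only: dim_span orthonormal_family_dim)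
  moreover have "dim ?P + dim ?S = DIM(real^'p)"
    using dim_subspace_orthogonal_to_vectors[of ?S UNIV] by simp
  moreover have "subspace ?P" by (auto simp: subspace_def orthogonal_def inner_add_right)
  then have "dim {x + y |x y. x \<in> ?P \<and> y \<in> ?T} + dim (?P \<inter> ?T) = dim ?P + dim ?T"
    by (intro dim_sums_Int) auto
  moreover have "dim {x + y |x y. x \<in> ?P \<and> y \<in> ?T} \<le> DIM(real^'p)" by (rule dim_subset_UNIV)
  ultimately have "dim (?P \<inter> ?T) \<noteq> 0" by linarith
  then obtain x where x: "x \<in> ?P" "x \<in> ?T" "x \<noteq> 0" by (auto simp: dim_eq_0)
  have Vx: "V j \<bullet> x = 0" if "j < i" for j
    using x(1) that by (auto simp: orthogonal_def span_base)
  obtain c where c: "x = (\<Sum>v\<in>V' ` {..<Suc i}. c v *\<^sub>R v)"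
    using x(2) by (auto simp: span_finite)
  have "inj_on V' {..<Suc i}" using \<open>orthonormal_family (Suc i) V'\<close> by (rule orthonormal_family_inj)
  then have xV': "x = (\<Sum>j<Suc i. c (V' j) *\<^sub>R V' j)"
    using c by (simp only: sum.reindex o_def)
  have cj: "V' j \<bullet> x = c (V' j)" if "j < Suc i" for j
    unfolding xV' using that by (rule orthonormal_family_inner_sum[OF \<open>orthonormal_family (Suc i) V'\<close>])
  have nx: "(norm x)\<^sup>2 = (\<Sum>j<Suc i. (c (V' j))\<^sup>2)"
    unfolding xV' by (rule norm_orthonormal_sum) fact
  have "(s' i)\<^sup>2 * (norm x)\<^sup>2 \<le> (\<Sum>j<Suc i. (s' j)\<^sup>2 * (V' j \<bullet> x)\<^sup>2)"
    unfolding nx sum_distrib_left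
  proof (rule sum_mono)
    fix j assume "j \<in> {..<Suc i}"
    then have "V' j \<bullet> x = c (V' j)" "0 \<le> s' i" "s' i \<le> s' j"
      using cj[of j] i 2 by (auto simp: is_svd_def)
    then show "(s' i)\<^sup>2 * (c (V' j))\<^sup>2 \<le> (s' j)\<^sup>2 * (V' j \<bullet> x)\<^sup>2"
      by (simp add: mult_right_mono power_mono)
  qed
  also have "\<dots> \<le> (\<Sum>j<?m. (s' j)\<^sup>2 * (V' j \<bullet> x)\<^sup>2)"
    using i by (intro sum_mono2) auto
  also have "\<dots> = (\<Sum>j<?m. (s j)\<^sup>2 * (V j \<bullet> x)\<^sup>2)"
    using is_svd_norm[OF 1, of x] is_svd_norm[OF 2, of x] by simp
  also have "\<dots> \<le> (\<Sum>j<?m. (s i)\<^sup>2 * (V j \<bullet> x)\<^sup>2)"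
  proof (rule sum_mono)
    fix j assume "j \<in> {..<?m}"
    then show "(s j)\<^sup>2 * (V j \<bullet> x)\<^sup>2 \<le> (s i)\<^sup>2 * (V j \<bullet> x)\<^sup>2"
      using 1 Vx[of j] by (cases "j < i") (auto simp: is_svd_def mult_right_mono power_mono)
  qed
  also have "\<dots> \<le> (s i)\<^sup>2 * (norm x)\<^sup>2"
    unfolding sum_distrib_left[symmetric] using bessel[OF V] by (intro mult_left_mono) auto
  finally have "(s' i)\<^sup>2 \<le> (s i)\<^sup>2" using x(3) by simp
  then show ?thesis using 1 i by (auto simp: is_svd_def intro: power2_le_imp_le)
qed

lemma is_svd_cong:
  fixes A :: "real^'p^'k"
  assumes "\<And>i. i < min_dim A \<Longrightarrow> s i = s' i" and "is_svd A U s V"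
  shows "is_svd A U s' V"
proof -
  have "(\<Sum>i<min_dim A. s i *\<^sub>R outer (U i) (V i)) = (\<Sum>i<min_dim A. s' i *\<^sub>R outer (U i) (V i))"
    by (rule sum.cong) (auto simp: assms(1))
  moreover have "\<forall>i<min_dim A. 0 \<le> s' i" "\<forall>i j. i \<le> j \<and> j < min_dim A \<longrightarrow> s' j \<le> s' i"
    using assms(2) by (auto simp: is_svd_def assms(1)[symmetric])
  ultimately show ?thesis using assms(2) unfolding is_svd_def by metis
qed

lemma is_svd_unique:
  assumes "is_svd A U s V" "is_svd A U' s' V'" "i < min_dim A"
  shows "s i = s' i"
  using is_svd_le[OF assms] is_svd_le[OF assms(2,1,3)] by (rule antisym[rotated])

theorem ex1_sing_val:
  fixes A :: "real^'p^'k"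
  shows "\<exists>!s. (\<exists>U V. is_svd A U s V) \<and> (\<forall>i\<ge>min_dim A. s i = 0)"
proof (rule ex_ex1I)
  obtain U s V where svd: "is_svd A U s V" using svd_exists by blast
  have "is_svd A U (\<lambda>i. if i < min_dim A then s i else 0) V"
    by (rule is_svd_cong[OF _ svd]) simp
  then show "\<exists>s. (\<exists>U V. is_svd A U s V) \<and> (\<forall>i\<ge>min_dim A. s i = 0)"
    by (intro exI[of _ "\<lambda>i. if i < min_dim A then s i else 0"]) auto
next
  fix s s'
  assume s: "(\<exists>U V. is_svd A U s V) \<and> (\<forall>i\<ge>min_dim A. s i = 0)"
    and s': "(\<exists>U V. is_svd A U s' V) \<and> (\<forall>i\<ge>min_dim A. s' i = 0)"
  then obtain U V U' V' where "is_svd A U s V" "is_svd A U' s' V'" by blast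
  then have "s i = s' i" if "i < min_dim A" for i using that by (rule is_svd_unique)
  with s s' show "s = s'" by (metis ext not_le)
qed

corollary is_svd_sing_val:
  assumes "is_svd A U s V" "i < min_dim A"
  shows "sing_val A i = s i"
proof -
  obtain U' V' where "is_svd A U' (sing_val A) V'"
    using theI'[OF ex1_sing_val[of A]] by (auto simp: sing_val_def)
  from is_svd_unique[OF this assms] show ?thesis .
qed

section \<open>Matrix norms and Schatten balls\<close>

definition nuclear_norm :: "real^'p^'k \<Rightarrow> real" where
  "nuclear_norm A = (\<Sum>i<min_dim A. sing_val A i)"

definition op_norm :: "real^'p^'k \<Rightarrow> real" where
  "op_norm A = Max (sing_val A ` {..<min_dim A})"

text \<open>The library sets \<open>0 powr 0 = 0\<close>, which is the convention wanted here: for \<open>q = 0\<close> the sum counts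
  the nonzero singular values.\<close>

definition schatten_ball :: "real \<Rightarrow> real \<Rightarrow> (real^'p^'k) set" where
  "schatten_ball q R = {A. (\<Sum>i<min_dim A. sing_val A i powr q) \<le> R}"

section \<open>The perturbation subspace and the cone-like set\<close>

text \<open>A $k \times r$ matrix is given by its \<open>r\<close> columns \<open>U 0, \<dots>, U (r - 1)\<close>, so that the number of columns
  is a term; then $U U^T$ is the sum of the outer products of the columns with themselves.\<close>

definition perp_model :: "nat \<Rightarrow> (nat \<Rightarrow> real^'k) \<Rightarrow> (nat \<Rightarrow> real^'p) \<Rightarrow> (real^'p^'k) set" where
  "perp_model r U V =
     {A. (\<forall>x\<in>span (rows A). \<forall>y\<in>span (V ` {..<r}). orthogonal x y) \<and>
         (\<forall>x\<in>span (columns A). \<forall>y\<in>span (U ` {..<r}). orthogonal x y)}"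

definition perp_proj ::
  "nat \<Rightarrow> (nat \<Rightarrow> real^'k) \<Rightarrow> (nat \<Rightarrow> real^'p) \<Rightarrow> real^'p^'k \<Rightarrow> real^'p^'k" where
  "perp_proj r U V A =
     (mat 1 - (\<Sum>i<r. outer (U i) (U i))) ** A ** (mat 1 - (\<Sum>i<r. outer (V i) (V i)))"

lemma mem_perp_model_iff:
  "A \<in> perp_model r U V \<longleftrightarrow> (\<forall>i<r. A *v V i = 0 \<and> U i v* A = 0)"
proof -
  have sp: "(\<forall>x\<in>span S. \<forall>y\<in>span T. orthogonal x y) \<longleftrightarrow> (\<forall>x\<in>S. \<forall>y\<in>T. orthogonal x y)"
    for S T :: "(real^'n) set"
    by (meson orthogonal_commute orthogonal_to_span span_base)
  have "(\<forall>x\<in>rows A. orthogonal x y) \<longleftrightarrow> A *v y = 0" for y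
    by (auto simp: rows_def row_def orthogonal_def vec_eq_iff matrix_vector_mult_def inner_vec_def)
  moreover have "(y v* A) $ j = column j A \<bullet> y" for y j
    by (simp add: column_def vector_matrix_mult_def inner_vec_def mult.commute)
  then have "(\<forall>x\<in>columns A. orthogonal x y) \<longleftrightarrow> y v* A = 0" for y
    unfolding vec_eq_iff[of "y v* A"] by (auto simp: columns_def orthogonal_def)
  ultimately show ?thesis unfolding perp_model_def sp by blast
qed

lemma inner_matrix_vec_outer: "A \<bullet> outer u v = u \<bullet> (A *v v)"
  by (simp add: inner_vec_def outer_def matrix_vector_mult_def sum_distrib_left mult_ac)

lemma orthonormal_family_proj:
  assumes "orthonormal_family r U" "j < r"
  shows "(mat 1 - (\<Sum>i<r. outer (U i) (U i))) *v U j = 0" (is "?M *v _ = 0")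
    and "U j v* (mat 1 - (\<Sum>i<r. outer (U i) (U i))) = 0"
proof -
  have "(\<Sum>i<r. outer (U i) (U i)) *v U j = (\<Sum>i<r. if i = j then U i else 0)"
    unfolding sum_mat_vec outer_mult_vec using orthonormal_familyD[OF assms(1) _ assms(2)]
    by (intro sum.cong) auto
  then show *: "?M *v U j = 0"
    using assms(2) by (simp add: matrix_vector_mult_diff_rdistrib)
  have "transpose ?M = ?M"
    by (simp add: vec_eq_iff transpose_def outer_def mat_def mult.commute)
  then have "U j v* ?M = U j v* transpose ?M" by (rule arg_cong[where f = "\<lambda>M. U j v* M", symmetric])
  then show "U j v* ?M = 0" by (simp only: vector_transpose_matrix *)
qed

text \<open>\<open>perp_proj\<close> is the orthogonal projection onto \<open>perp_model\<close>.\<close>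

lemma perp_proj_in_perp_model:
  assumes "orthonormal_family r U" "orthonormal_family r V"
  shows "perp_proj r U V A \<in> perp_model r U V"
  using orthonormal_family_proj[OF assms(1)] orthonormal_family_proj[OF assms(2)]
  by (simp add: mem_perp_model_iff perp_proj_def matrix_vector_mul_assoc[symmetric]
      vector_matrix_mul_assoc[symmetric])

lemma matrix_diff_distrib:
  fixes A B :: "real^'p^'k"
  shows "C ** (A - B) = C ** A - C ** B" and "(A - B) ** D = A ** D - B ** D"
  by (simp_all add: vec_eq_iff matrix_matrix_mult_def algebra_simps sum_subtractf)

lemma perp_proj_orthogonal:
  fixes A B :: "real^'p^'k"
  assumes B: "B \<in> perp_model r U V"
  shows "orthogonal (A - perp_proj r U V A) B"
proof -
  let ?P = "\<Sum>i<r. outer (U i) (U i)" and ?Q = "\<Sum>i<r. outer (V i) (V i)"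
  have P: "?P ** C = (\<Sum>i<r. outer (U i) (U i v* C))" for C :: "real^'c^'k"
  proof -
    have "(?P ** C) *v x = (\<Sum>i<r. outer (U i) (U i v* C)) *v x" for x
      by (simp add: matrix_vector_mul_assoc[symmetric] sum_mat_vec outer_mult_vec dot_lmul_matrix)
    then show ?thesis by (simp add: matrix_eq)
  qed
  have Q: "C ** ?Q = (\<Sum>i<r. outer (C *v V i) (V i))" for C :: "real^'p^'k"
  proof -
    have "(C ** ?Q) *v x = (\<Sum>i<r. outer (C *v V i) (V i)) *v x" for x
      by (simp add: matrix_vector_mul_assoc[symmetric] sum_mat_vec outer_mult_vec
          linear_sum[OF matrix_vector_mul_linear] matrix_vector_mult_scaleR)
    then show ?thesis by (simp add: matrix_eq)
  qed
  have "A - perp_proj r U V A = ?P ** A + ((mat 1 - ?P) ** A) ** ?Q"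
    by (simp add: perp_proj_def matrix_diff_distrib)
  moreover have "(?P ** A) \<bullet> B = 0" "(C ** ?Q) \<bullet> B = 0" for C
  proof -
    have B0: "B *v V i = 0" "U i v* B = 0" if "i < r" for i
      using B that by (auto simp: mem_perp_model_iff)
    show "(?P ** A) \<bullet> B = 0"
      unfolding P inner_commute[of _ B] inner_sum_right inner_matrix_vec_outer dot_lmul_matrix[symmetric]
      by (simp add: B0)
    show "(C ** ?Q) \<bullet> B = 0"
      unfolding Q inner_commute[of _ B] inner_sum_right inner_matrix_vec_outer by (simp add: B0)
  qed
  ultimately show ?thesis by (simp add: orthogonal_def inner_add_left)
qed

definition cone_set ::
  "(nat \<Rightarrow> real^'k) \<Rightarrow> (nat \<Rightarrow> real^'p) \<Rightarrow> real^'p^'k \<Rightarrow> nat \<Rightarrow> real \<Rightarrow> (real^'p^'k) set" where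
  "cone_set U V \<Theta>s r \<delta> =
     {\<Delta>. \<delta> \<le> norm \<Delta> \<and>
          nuclear_norm (perp_proj r U V \<Delta>)
            \<le> 3 * nuclear_norm (\<Delta> - perp_proj r U V \<Delta>) + 4 * nuclear_norm (perp_proj r U V \<Theta>s)}"

definition cone_set_real ::
  "(nat \<Rightarrow> real^'k) \<Rightarrow> (nat \<Rightarrow> real^'p) \<Rightarrow> real^'p^'k \<Rightarrow> real \<Rightarrow> real \<Rightarrow> (real^'p^'k) set" where
  "cone_set_real U V \<Theta>s x \<delta> = cone_set U V \<Theta>s (min (nat \<lfloor>x\<rfloor>) (min_dim \<Theta>s)) \<delta>"

section \<open>Observation model\<close>

definition obs_op :: "(real^'p^'k)^'n \<Rightarrow> real^'p^'k \<Rightarrow> real^'n" where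
  "obs_op X \<Theta> = (\<chi> i. trace (transpose (X $ i) ** \<Theta>))"

definition obs_adj :: "(real^'p^'k)^'n \<Rightarrow> real^'n \<Rightarrow> real^'p^'k" where
  "obs_adj X \<epsilon> = (\<Sum>i\<in>UNIV. \<epsilon> $ i *\<^sub>R X $ i)"

definition rsc :: "(real^'p^'k)^'n \<Rightarrow> real \<Rightarrow> (real^'p^'k) set \<Rightarrow> bool" where
  "rsc (X :: (real^'p^'k)^'n) \<kappa> C \<longleftrightarrow>
     (\<forall>\<Delta>\<in>C. 1 / (2 * real CARD('n)) * (norm (obs_op X \<Delta>))\<^sup>2 \<ge> \<kappa> * (norm \<Delta>)\<^sup>2)"

definition objective :: "(real^'p^'k)^'n \<Rightarrow> real^'n \<Rightarrow> real \<Rightarrow> real^'p^'k \<Rightarrow> real" where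
  "objective (X :: (real^'p^'k)^'n) y lam \<Theta> =
     1 / (2 * real CARD('n)) * (norm (y - obs_op X \<Theta>))\<^sup>2 + lam * nuclear_norm \<Theta>"

end

theory Submission
  imports Defs
begin

text \<open>
  Let \<open>\<Delta>\<close> be the estimation error and, for a rank cutoff \<open>r\<close>, let \<open>\<Delta>2 = perp_proj r U V \<Delta>\<close> be its
  component in the perturbation subspace and \<open>\<Delta>1 = \<Delta> - \<Delta>2\<close>. Comparing the objective at the minimiser
  and at the true matrix, with the noise term at most \<open>lam / 2\<close> times the sum of the nuclear norms of \<open>\<Delta>1\<close>
  and \<open>\<Delta>2\<close>, bounds the prediction error
  \<open>1 / (2 * N) * (norm (obs_op X \<Delta>))\<^sup>2\<close>, for \<^emph>\<open>every\<close> \<open>r\<close>, by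
  \<open>lam / 2 * (3 * nuclear_norm \<Delta>1 - nuclear_norm \<Delta>2 + 4 * t)\<close>, where \<open>t\<close> is the sum of the singular values
  of the true matrix beyond the first \<open>r\<close> (\<open>error_basic_inequality\<close>). This rests on the additivity of the nuclear norm
  on the sum of \<open>\<Delta>2\<close> and the top \<open>r\<close> part of the true matrix, whose row and column spaces are orthogonal
  (\<open>nuclear_norm_add_ge\<close>). All facts about the nuclear norm come from its duality with the matrices that do
  not increase the Euclidean norm: a lower bound on a nuclear norm is obtained by exhibiting one of them.

  The inequality is used with two different cutoffs. With \<open>r\<close> given by \<open>R\<^sub>q * lam powr (- q)\<close>,
  nonnegativity of the prediction error puts \<open>\<Delta>\<close>, if \<open>norm \<Delta> > \<delta>\<close>, into the set on which restricted strong
  convexity is assumed, so the prediction error is at least \<open>\<kappa> * (norm \<Delta>)\<^sup>2\<close>. This lower bound no longer involves \<open>r\<close>, so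
  the upper bound may be taken with another cutoff, given by \<open>R\<^sub>q * \<eta> powr (- q)\<close> with \<open>\<eta> = lam / \<kappa>\<close>; with
  the first cutoff this argument would lose a factor of \<open>\<kappa> powr (- q / 2)\<close>. For the second one,
  \<open>nuclear_norm \<Delta>1\<close> is at most \<open>2 * sqrt r * norm \<Delta>\<close> (\<open>nuclear_norm_diff_perp_proj_le\<close>) and the tail of the
  singular values is at most \<open>R\<^sub>q * \<eta> powr (1 - q)\<close> (\<open>powr_sparse_tail\<close>). With
  \<open>b = sqrt R\<^sub>q * \<eta> powr (1 - q / 2)\<close> the outcome is a quadratic inequality
  \<open>T\<^sup>2 \<le> 3 * b * T + 2 * b\<^sup>2\<close> for \<open>T = norm \<Delta>\<close>, which forces \<open>T \<le> 4 * b\<close>.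
\<close>

section \<open>Duality for the nuclear norm\<close>

definition nonexpansive :: "real^'p^'k \<Rightarrow> bool" where
  "nonexpansive W \<longleftrightarrow> (\<forall>x. norm (W *v x) \<le> norm x)"

lemma nuclear_norm_svd:
  assumes "is_svd A U s V"
  shows "nuclear_norm A = (\<Sum>i<min_dim A. s i)"
  unfolding nuclear_norm_def by (intro sum.cong) (auto simp: is_svd_sing_val[OF assms])

lemma orthonormal_family_norm:
  assumes "orthonormal_family n U" "i < n"
  shows "norm (U i) = 1"
  using orthonormal_familyD[OF assms assms(2)] by (simp add: norm_eq_1)

lemma orthonormal_family_mono:
  assumes "orthonormal_family n U" "m \<le> n"
  shows "orthonormal_family m U"
  using assms by (auto simp: orthonormal_family_def)

lemma inner_svd:
  assumes "is_svd A U s V"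
  shows "W \<bullet> A = (\<Sum>i<min_dim A. s i * (U i \<bullet> (W *v V i)))"
proof -
  define m where "m = min_dim A"
  have A: "A = (\<Sum>i<m. s i *\<^sub>R outer (U i) (V i))"
    using assms unfolding is_svd_def m_def by blast
  have "W \<bullet> A = (\<Sum>i<m. s i * (U i \<bullet> (W *v V i)))"
    by (subst A) (simp add: inner_sum_right inner_matrix_vec_outer)
  then show ?thesis by (simp add: m_def)
qed

text \<open>Each outer product in a singular value decomposition pairs with \<open>W\<close> to at most \<open>c\<close>. The case \<open>c = 1\<close> is
  one half of the duality; the case \<open>c = op_norm W\<close> is Hoelder's inequality, which bounds the noise term.\<close>

lemma abs_inner_le_nuclear_norm:
  assumes W: "\<And>x. norm (W *v x) \<le> c * norm x"
  shows "\<bar>W \<bullet> A\<bar> \<le> c * nuclear_norm A"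
proof -
  obtain U s V where svd: "is_svd A U s V" using svd_exists by blast
  then have U: "orthonormal_family (min_dim A) U" and V: "orthonormal_family (min_dim A) V"
    and s: "\<And>i. i < min_dim A \<Longrightarrow> 0 \<le> s i"
    by (auto simp: is_svd_def)
  have "\<bar>W \<bullet> A\<bar> \<le> (\<Sum>i<min_dim A. \<bar>s i * (U i \<bullet> (W *v V i))\<bar>)"
    unfolding inner_svd[OF svd] by (rule sum_abs)
  also have "\<dots> \<le> (\<Sum>i<min_dim A. c * s i)"
  proof (rule sum_mono)
    fix i assume "i \<in> {..<min_dim A}"
    then have i: "i < min_dim A" by simp
    have "\<bar>U i \<bullet> (W *v V i)\<bar> \<le> norm (U i) * norm (W *v V i)" by (rule Cauchy_Schwarz_ineq2)
    also have "\<dots> \<le> c"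
      using W[of "V i"] by (simp add: orthonormal_family_norm[OF U i] orthonormal_family_norm[OF V i])
    finally show "\<bar>s i * (U i \<bullet> (W *v V i))\<bar> \<le> c * s i"
      using s[OF i] by (simp add: abs_mult mult.commute[of c] mult_left_mono)
  qed
  also have "\<dots> = c * nuclear_norm A"
    by (simp add: nuclear_norm_svd[OF svd] sum_distrib_left)
  finally show ?thesis .
qed

lemma nonexpansive_abs_inner_le:
  assumes "nonexpansive W"
  shows "\<bar>W \<bullet> A\<bar> \<le> nuclear_norm A"
  using abs_inner_le_nuclear_norm[of W 1 A] assms by (simp add: nonexpansive_def)

lemma nuclear_norm_nonneg: "0 \<le> nuclear_norm A"
  using nonexpansive_abs_inner_le[of 0 A] by (simp add: nonexpansive_def)

lemma norm_mult_vec_le_op_norm: "norm (A *v x) \<le> op_norm A * norm x"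
proof -
  obtain U s V where svd: "is_svd A U s V" using svd_exists by blast
  then have V: "orthonormal_family (min_dim A) V" and s: "\<And>i. i < min_dim A \<Longrightarrow> 0 \<le> s i"
    by (auto simp: is_svd_def)
  have le: "s i \<le> op_norm A" if "i < min_dim A" for i
    unfolding op_norm_def using that by (intro Max_ge) (auto simp: is_svd_sing_val[OF svd, symmetric])
  have "0 < min_dim A" by (simp add: min_dim_def)
  then have op: "0 \<le> op_norm A" using s[of 0] le[of 0] by simp
  have "(norm (A *v x))\<^sup>2 \<le> (\<Sum>i<min_dim A. (op_norm A)\<^sup>2 * (V i \<bullet> x)\<^sup>2)"
    unfolding is_svd_norm[OF svd] using s le by (intro sum_mono mult_right_mono power_mono) auto
  also have "\<dots> \<le> (op_norm A)\<^sup>2 * (norm x)\<^sup>2"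
    unfolding sum_distrib_left[symmetric] using bessel[OF V] by (intro mult_left_mono) auto
  finally have "(norm (A *v x))\<^sup>2 \<le> (op_norm A * norm x)\<^sup>2" by (simp add: power_mult_distrib)
  then show ?thesis using op by (auto intro: power2_le_imp_le)
qed

lemma sum_outer_mult_vec:
  "(\<Sum>i<n. c i *\<^sub>R outer (U i) (V i)) *v x = (\<Sum>i<n. (c i * (V i \<bullet> x)) *\<^sub>R U i)"
  by (simp add: sum_mat_vec scaleR_matrix_vector_assoc[symmetric] outer_mult_vec)

lemma nonexpansive_sum_outer:
  assumes U: "orthonormal_family n U" and V: "orthonormal_family n V"
    and c: "\<And>i. i < n \<Longrightarrow> \<bar>c i\<bar> \<le> 1"
  shows "nonexpansive (\<Sum>i<n. c i *\<^sub>R outer (U i) (V i))"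
  unfolding nonexpansive_def
proof
  fix x
  have "(norm ((\<Sum>i<n. c i *\<^sub>R outer (U i) (V i)) *v x))\<^sup>2 = (\<Sum>i<n. (c i)\<^sup>2 * (V i \<bullet> x)\<^sup>2)"
    by (simp add: sum_outer_mult_vec norm_orthonormal_sum[OF U] power_mult_distrib)
  also have "\<dots> \<le> (\<Sum>i<n. (V i \<bullet> x)\<^sup>2)"
    using c by (intro sum_mono mult_left_le_one_le) (auto simp: abs_square_le_1)
  also have "\<dots> \<le> (norm x)\<^sup>2" by (rule bessel[OF V])
  finally show "norm ((\<Sum>i<n. c i *\<^sub>R outer (U i) (V i)) *v x) \<le> norm x"
    by (rule power2_le_imp_le) simp
qed

lemma inner_sum_outer_svd:
  assumes svd: "is_svd A U s V" and n: "n \<le> min_dim A"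
  shows "(\<Sum>i<n. c i *\<^sub>R outer (U i) (V i)) \<bullet> A = (\<Sum>i<n. c i * s i)"
proof -
  define m where "m = min_dim A"
  have A: "A = (\<Sum>i<m. s i *\<^sub>R outer (U i) (V i))" and U: "orthonormal_family m U"
    and V: "orthonormal_family m V"
    using svd unfolding is_svd_def m_def by blast+
  have "U i \<bullet> (A *v V i) = s i" if "i < m" for i
  proof -
    have "U i \<bullet> (A *v V i) = s i * (V i \<bullet> V i)"
      by (subst A, unfold sum_outer_mult_vec) (rule orthonormal_family_inner_sum[OF U that])
    then show ?thesis using orthonormal_familyD[OF V that that] by simp
  qed
  then show ?thesis
    using n by (subst inner_commute) (simp add: inner_sum_right inner_matrix_vec_outer m_def)
qed

lemma nuclear_norm_attained:
  obtains W where "nonexpansive W" "W \<bullet> A = nuclear_norm A"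
proof -
  obtain U s V where svd: "is_svd A U s V" using svd_exists by blast
  let ?W = "\<Sum>i<min_dim A. 1 *\<^sub>R outer (U i) (V i)"
  have "nonexpansive ?W" using svd by (intro nonexpansive_sum_outer) (auto simp: is_svd_def)
  moreover have "?W \<bullet> A = nuclear_norm A"
    by (subst inner_sum_outer_svd[OF svd order.refl]) (simp add: nuclear_norm_svd[OF svd])
  ultimately show ?thesis by (rule that)
qed

section \<open>The two components of a matrix relative to the model subspaces\<close>

definition compl_proj :: "nat \<Rightarrow> (nat \<Rightarrow> 'a::real_inner) \<Rightarrow> 'a \<Rightarrow> 'a" where
  "compl_proj r U x = x - (\<Sum>i<r. (U i \<bullet> x) *\<^sub>R U i)"

lemma linear_compl_proj: "linear (compl_proj r U)"
  by (rule linearI)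
    (simp_all add: compl_proj_def inner_add_right scaleR_add_left sum.distrib scaleR_diff_right
      scaleR_sum_right)

lemma compl_proj_orthogonal:
  assumes "orthonormal_family r U" "j < r"
  shows "U j \<bullet> compl_proj r U x = 0"
  by (simp add: compl_proj_def inner_diff_right orthonormal_family_inner_sum[OF assms])

lemma norm_compl_proj:
  assumes U: "orthonormal_family r U"
  shows "(norm (compl_proj r U x))\<^sup>2 = (norm x)\<^sup>2 - (\<Sum>i<r. (U i \<bullet> x)\<^sup>2)"
proof -
  let ?y = "\<Sum>i<r. (U i \<bullet> x) *\<^sub>R U i"
  have "x \<bullet> ?y = (\<Sum>i<r. (U i \<bullet> x)\<^sup>2)"
    by (simp add: inner_sum_right inner_commute power2_eq_square)
  moreover have "(norm (x - ?y))\<^sup>2 = (norm x)\<^sup>2 - 2 * (x \<bullet> ?y) + (norm ?y)\<^sup>2"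
    by (simp add: power2_norm_eq_inner algebra_simps inner_commute)
  ultimately show ?thesis
    using norm_orthonormal_sum[OF U, of "\<lambda>i. U i \<bullet> x"] by (simp add: compl_proj_def)
qed

lemma norm_compl_proj_le:
  assumes "orthonormal_family r U"
  shows "norm (compl_proj r U x) \<le> norm x"
  using norm_compl_proj[OF assms, of x] sum_nonneg[of "{..<r}" "\<lambda>i. (U i \<bullet> x)\<^sup>2"]
  by (auto intro: power2_le_imp_le)

lemma perp_proj_mult_vec:
  "perp_proj r U V A *v x = compl_proj r U (A *v compl_proj r V x)"
  by (simp add: perp_proj_def compl_proj_def matrix_vector_mul_assoc[symmetric]
      matrix_vector_mult_diff_rdistrib sum_mat_vec outer_mult_vec)

text \<open>The two summands act on orthogonal components of \<open>x\<close> and have orthogonal ranges, so the bounds combine by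
  Pythagoras on both sides. Adding \<open>perp_proj r U V W\<close> extends the dual certificate of the top \<open>r\<close> singular
  pairs to the perturbation subspace.\<close>

lemma nonexpansive_add_perp_proj:
  assumes U: "orthonormal_family r U" and V: "orthonormal_family r V" and W: "nonexpansive W"
  shows "nonexpansive ((\<Sum>i<r. outer (U i) (V i)) + perp_proj r U V W)"
  unfolding nonexpansive_def
proof
  fix x
  let ?a = "\<Sum>i<r. (V i \<bullet> x) *\<^sub>R U i" and ?b = "compl_proj r U (W *v compl_proj r V x)"
  have "?a \<bullet> ?b = 0" by (simp add: inner_sum_left compl_proj_orthogonal[OF U])
  then have "(norm (?a + ?b))\<^sup>2 = (norm ?a)\<^sup>2 + (norm ?b)\<^sup>2"
    by (simp add: power2_norm_eq_inner algebra_simps inner_commute)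
  also have "(norm ?a)\<^sup>2 = (\<Sum>i<r. (V i \<bullet> x)\<^sup>2)" by (rule norm_orthonormal_sum[OF U])
  also have "(norm ?b)\<^sup>2 \<le> (norm (compl_proj r V x))\<^sup>2"
    using norm_compl_proj_le[OF U, of "W *v compl_proj r V x"] W
    by (intro power_mono) (auto simp: nonexpansive_def intro: order.trans)
  also have "\<dots> = (norm x)\<^sup>2 - (\<Sum>i<r. (V i \<bullet> x)\<^sup>2)" by (rule norm_compl_proj[OF V])
  finally have "(norm (?a + ?b))\<^sup>2 \<le> (norm x)\<^sup>2" by simp
  then show "norm (((\<Sum>i<r. outer (U i) (V i)) + perp_proj r U V W) *v x) \<le> norm x"
    by (simp only: matrix_vector_mult_add_rdistrib sum_mat_vec outer_mult_vec perp_proj_mult_vec)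
      (rule power2_le_imp_le, auto)
qed

lemma inner_perp_proj_right:
  assumes "B \<in> perp_model r U V"
  shows "B \<bullet> perp_proj r U V A = B \<bullet> A"
  using perp_proj_orthogonal[OF assms, of A]
  by (simp add: orthogonal_def inner_diff_right inner_commute[of _ B])

text \<open>Approximate decomposability. A single certificate \<open>W\<close> is tested against \<open>A + \<Delta>\<close>: on the top \<open>r\<close> singular
  pairs of \<open>A\<close> it collects their full weight, on the component of \<open>\<Delta>\<close> in the perturbation subspace the full
  nuclear norm, and on the two remaining pieces it loses no more than their nuclear norms.\<close>

lemma nuclear_norm_add_ge:
  fixes A \<Delta> :: "real^'p^'k"
  assumes svd: "is_svd A U s V" and r: "r \<le> min_dim A"
  shows "nuclear_norm A - 2 * (\<Sum>i=r..<min_dim A. s i)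
           + nuclear_norm (perp_proj r U V \<Delta>) - nuclear_norm (\<Delta> - perp_proj r U V \<Delta>)
         \<le> nuclear_norm (A + \<Delta>)"
proof -
  let ?m = "min_dim A" and ?D2 = "perp_proj r U V \<Delta>" and ?W1 = "\<Sum>i<r. outer (U i) (V i)"
  have Um: "orthonormal_family ?m U" and Vm: "orthonormal_family ?m V"
    and s: "\<And>i. i < ?m \<Longrightarrow> 0 \<le> s i"
    using svd by (auto simp: is_svd_def)
  have U: "orthonormal_family r U" and V: "orthonormal_family r V"
    using Um Vm r by (auto intro: orthonormal_family_mono)
  obtain W2 :: "real^'p^'k" where W2: "nonexpansive W2" "W2 \<bullet> ?D2 = nuclear_norm ?D2"
    by (rule nuclear_norm_attained)
  let ?P2 = "perp_proj r U V W2"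
  define W where "W = ?W1 + ?P2"
  have W: "nonexpansive W" unfolding W_def by (rule nonexpansive_add_perp_proj[OF U V W2(1)])
  have split: "(\<Sum>i<?m. f i) = (\<Sum>i<r. f i) + (\<Sum>i=r..<?m. f i)" for f :: "nat \<Rightarrow> real"
    using sum.atLeastLessThan_concat[of 0 r ?m f] r by (simp add: lessThan_atLeast0)
  have D2: "?D2 \<in> perp_model r U V" and P2: "?P2 \<in> perp_model r U V"
    by (intro perp_proj_in_perp_model U V)+
  \<comment> \<open>The second summand of \<open>W\<close> vanishes on the first \<open>r\<close> right singular vectors; beyond them only
      nonexpansiveness is available.\<close>
  have A: "(\<Sum>i<r. s i) - (\<Sum>i=r..<?m. s i) \<le> W \<bullet> A"
  proof -
    have "U i \<bullet> (W *v V i) = 1" if "i < r" for i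
    proof -
      have "?P2 *v V i = 0" using P2 that by (simp add: mem_perp_model_iff)
      moreover have "U i \<bullet> (?W1 *v V i) = V i \<bullet> V i"
        unfolding sum_mat_vec outer_mult_vec by (rule orthonormal_family_inner_sum[OF U that])
      ultimately show ?thesis using orthonormal_familyD[OF V that that]
        by (simp add: W_def matrix_vector_mult_add_rdistrib)
    qed
    moreover have "- s i \<le> s i * (U i \<bullet> (W *v V i))" if "i < ?m" for i
    proof -
      have "\<bar>U i \<bullet> (W *v V i)\<bar> \<le> norm (U i) * norm (W *v V i)" by (rule Cauchy_Schwarz_ineq2)
      also have "\<dots> \<le> 1"
        using W orthonormal_family_norm[OF Um that] orthonormal_family_norm[OF Vm that]
        by (metis mult_1 nonexpansive_def)
      finally have "-1 \<le> U i \<bullet> (W *v V i)" by linarith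
      then show ?thesis using mult_left_mono[of "-1" _ "s i"] s[OF that] by fastforce
    qed
    then have "(\<Sum>i=r..<?m. - s i) \<le> (\<Sum>i=r..<?m. s i * (U i \<bullet> (W *v V i)))"
      by (intro sum_mono) auto
    ultimately show ?thesis unfolding inner_svd[OF svd] split by (simp add: sum_negf)
  qed
  have "?W1 \<bullet> ?D2 = 0"
    using D2 by (subst inner_commute) (simp add: inner_sum_right inner_matrix_vec_outer mem_perp_model_iff)
  moreover have "?P2 \<bullet> ?D2 = W2 \<bullet> ?D2"
    using inner_perp_proj_right[OF D2, of W2] by (simp add: inner_commute)
  ultimately have 2: "W \<bullet> ?D2 = nuclear_norm ?D2" using W2(2) by (simp add: W_def inner_add_left)
  have 1: "- nuclear_norm (\<Delta> - ?D2) \<le> W \<bullet> (\<Delta> - ?D2)"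
    using nonexpansive_abs_inner_le[OF W, of "\<Delta> - ?D2"] by linarith
  have "W \<bullet> (A + \<Delta>) = W \<bullet> A + W \<bullet> ?D2 + W \<bullet> (\<Delta> - ?D2)"
    by (simp add: inner_add_right inner_diff_right)
  moreover have "W \<bullet> (A + \<Delta>) \<le> nuclear_norm (A + \<Delta>)"
    using nonexpansive_abs_inner_le[OF W, of "A + \<Delta>"] by linarith
  ultimately show ?thesis using A 1 2 by (simp add: nuclear_norm_svd[OF svd] split)
qed

text \<open>The dual certificate of the singular pairs from \<open>r\<close> on lies in the perturbation subspace, so it cannot
  distinguish \<open>A\<close> from its projection. This turns the tail sum of \<open>nuclear_norm_add_ge\<close> into the nuclear norm
  that occurs in \<open>cone_set\<close>.\<close>

lemma tail_le_nuclear_norm_perp_proj: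
  assumes svd: "is_svd A U s V"
  shows "(\<Sum>i=r..<min_dim A. s i) \<le> nuclear_norm (perp_proj r U V A)"
proof -
  define m where "m = min_dim A"
  let ?c = "\<lambda>i. of_bool (r \<le> i) :: real"
  define T where "T = (\<Sum>i<m. ?c i *\<^sub>R outer (U i) (V i))"
  have U: "orthonormal_family m U" and V: "orthonormal_family m V"
    using svd by (auto simp: is_svd_def m_def)
  have "U i v* T = 0" "T *v V i = 0" if "i < r" for i
  proof -
    have "V j \<bullet> V i = 0" "U i \<bullet> U j = 0" if "j < m" "r \<le> j" for j
      using orthonormal_familyD[OF V, of j i] orthonormal_familyD[OF U, of i j] that \<open>i < r\<close> by auto
    then have 0: "?c j * (V j \<bullet> V i) = 0" "?c j * (U i \<bullet> U j) = 0" if "j < m" for j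
      using that by auto
    show "T *v V i = 0"
      unfolding T_def sum_outer_mult_vec using 0(1) by (intro sum.neutral) auto
    have "(U i v* T) \<bullet> x = (\<Sum>j<m. (?c j * (U i \<bullet> U j)) * (V j \<bullet> x))" for x
      by (simp add: dot_lmul_matrix T_def sum_outer_mult_vec inner_sum_right mult_ac)
    then have "(U i v* T) \<bullet> (U i v* T) = 0" using 0(2) by simp
    then show "U i v* T = 0" by simp
  qed
  then have "T \<in> perp_model r U V" by (simp add: mem_perp_model_iff)
  then have "T \<bullet> perp_proj r U V A = T \<bullet> A" by (rule inner_perp_proj_right)
  also have "\<dots> = (\<Sum>i<m. ?c i * s i)" unfolding T_def m_def by (rule inner_sum_outer_svd[OF svd order.refl])
  also have "\<dots> = (\<Sum>i=r..<m. s i)"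
    by (intro sum.mono_neutral_cong_right) auto
  finally have "T \<bullet> perp_proj r U V A = (\<Sum>i=r..<m. s i)" .
  moreover have "nonexpansive T" unfolding T_def by (rule nonexpansive_sum_outer[OF U V]) simp
  ultimately show ?thesis using nonexpansive_abs_inner_le[of T "perp_proj r U V A"] by (simp add: m_def)
qed

lemma norm_matrix_rows: "(norm (A :: real^'p^'k))\<^sup>2 = (\<Sum>i\<in>UNIV. (norm (A $ i))\<^sup>2)"
  by (simp add: power2_norm_eq_inner inner_vec_def)

lemma norm_transpose: "norm (transpose A) = norm (A :: real^'p^'k)"
proof -
  have "transpose A \<bullet> transpose A = A \<bullet> A"
    unfolding inner_vec_def transpose_def by (simp add: inner_vec_def) (rule sum.swap)
  then show ?thesis by (simp add: norm_eq_sqrt_inner)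
qed

text \<open>Bessel's inequality, applied to each row of \<open>A\<close>.\<close>

lemma sum_norm_mult_vec_le:
  fixes A :: "real^'p^'k"
  assumes "orthonormal_family r V"
  shows "(\<Sum>i<r. (norm (A *v V i))\<^sup>2) \<le> (norm A)\<^sup>2"
proof -
  have "(\<Sum>i<r. (norm (A *v V i))\<^sup>2) = (\<Sum>i<r. \<Sum>j\<in>UNIV. (V i \<bullet> A $ j)\<^sup>2)"
    by (simp add: norm_vec_def L2_set_def sum_nonneg matrix_vector_mult_def inner_vec_def mult.commute)
  also have "\<dots> = (\<Sum>j\<in>UNIV. \<Sum>i<r. (V i \<bullet> A $ j)\<^sup>2)" by (rule sum.swap)
  also have "\<dots> \<le> (\<Sum>j\<in>UNIV. (norm (A $ j))\<^sup>2)" by (intro sum_mono bessel assms)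
  finally show ?thesis by (simp add: norm_matrix_rows)
qed

lemma sum_norm_le:
  fixes w :: "nat \<Rightarrow> 'a::real_normed_vector"
  assumes "(\<Sum>i<r. (norm (w i))\<^sup>2) \<le> t\<^sup>2" "0 \<le> t"
  shows "(\<Sum>i<r. norm (w i)) \<le> sqrt (real r) * t"
proof -
  have "(\<Sum>i<r. norm (w i))\<^sup>2 \<le> real r * (\<Sum>i<r. (norm (w i))\<^sup>2)"
    using Cauchy_Schwarz_ineq_sum[of "\<lambda>_. 1" "\<lambda>i. norm (w i)" "{..<r}"] by simp
  also have "\<dots> \<le> real r * t\<^sup>2" using assms by (intro mult_left_mono) auto
  also have "\<dots> = (sqrt (real r) * t)\<^sup>2" by (simp add: power_mult_distrib)
  finally show ?thesis using assms by (auto intro: power2_le_imp_le)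
qed

text \<open>The difference is a sum of two matrices of rank at most \<open>r\<close>, one with columns in the span of \<open>U\<close> and one
  with rows in the span of \<open>V\<close>. Each is a sum of \<open>r\<close> outer products with one unit factor, and the lengths of
  the other factors are square summable to at most \<open>(norm A)\<^sup>2\<close>.\<close>

lemma nuclear_norm_diff_perp_proj_le:
  fixes A :: "real^'p^'k"
  assumes U: "orthonormal_family r U" and V: "orthonormal_family r V"
  shows "nuclear_norm (A - perp_proj r U V A) \<le> 2 * sqrt (real r) * norm A"
proof -
  let ?D = "A - perp_proj r U V A"
  have D: "?D = (\<Sum>i<r. outer (U i) (U i v* A)) + (\<Sum>i<r. outer (compl_proj r U (A *v V i)) (V i))"
  proof -
    have "?D *v x = ((\<Sum>i<r. outer (U i) (U i v* A)) + (\<Sum>i<r. outer (compl_proj r U (A *v V i)) (V i))) *v x" for x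
    proof -
      have 1: "compl_proj r U (A *v compl_proj r V x)
          = compl_proj r U (A *v x) - (\<Sum>i<r. (V i \<bullet> x) *\<^sub>R compl_proj r U (A *v V i))"
        by (simp add: compl_proj_def[of r V] matrix_vector_mult_diff_distrib
            linear_sum[OF matrix_vector_mul_linear] matrix_vector_mult_scaleR
            linear_diff[OF linear_compl_proj] linear_sum[OF linear_compl_proj]
            linear_cmul[OF linear_compl_proj])
      have 2: "compl_proj r U (A *v x) = A *v x - (\<Sum>i<r. (U i \<bullet> (A *v x)) *\<^sub>R U i)"
        by (simp add: compl_proj_def)
      show ?thesis
        by (simp add: matrix_vector_mult_diff_rdistrib matrix_vector_mult_add_rdistrib sum_mat_vec
            outer_mult_vec dot_lmul_matrix perp_proj_mult_vec 1 2)
    qed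
    then show ?thesis by (simp add: matrix_eq)
  qed
  obtain W :: "real^'p^'k" where W: "nonexpansive W" "W \<bullet> ?D = nuclear_norm ?D"
    by (rule nuclear_norm_attained)
  have Wn: "u \<bullet> (W *v v) \<le> norm u * norm v" for u v
    using norm_cauchy_schwarz[of u "W *v v"] W(1) mult_left_mono[of "norm (W *v v)" "norm v" "norm u"]
    unfolding nonexpansive_def by fastforce
  have "nuclear_norm ?D = (\<Sum>i<r. U i \<bullet> (W *v (U i v* A))) + (\<Sum>i<r. compl_proj r U (A *v V i) \<bullet> (W *v V i))"
    unfolding W(2)[symmetric] by (subst D) (simp add: inner_add_right inner_sum_right inner_matrix_vec_outer)
  also have "\<dots> \<le> (\<Sum>i<r. norm (U i v* A)) + (\<Sum>i<r. norm (A *v V i))"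
  proof (intro add_mono sum_mono)
    fix i assume "i \<in> {..<r}"
    then have i: "norm (U i) = 1" "norm (V i) = 1"
      using U V by (auto intro: orthonormal_family_norm)
    show "U i \<bullet> (W *v (U i v* A)) \<le> norm (U i v* A)" using Wn[of "U i" "U i v* A"] i by simp
    show "compl_proj r U (A *v V i) \<bullet> (W *v V i) \<le> norm (A *v V i)"
      using Wn[of "compl_proj r U (A *v V i)" "V i"] i norm_compl_proj_le[OF U, of "A *v V i"] by simp
  qed
  also have "(\<Sum>i<r. norm (A *v V i)) \<le> sqrt (real r) * norm A"
    by (intro sum_norm_le sum_norm_mult_vec_le V) simp
  also have "(\<Sum>i<r. norm (U i v* A)) \<le> sqrt (real r) * norm A"
    using sum_norm_mult_vec_le[OF U, of "transpose A"]
    by (intro sum_norm_le) (simp_all add: norm_transpose transpose_matrix_vector)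
  finally show ?thesis by (simp add: mult_ac)
qed

section \<open>Tails of weakly sparse sequences\<close>

text \<open>The cutoff is chosen so that a nonzero entry at position \<open>r\<close> or later lies below \<open>\<eta>\<close>: otherwise the first
  \<open>r + 1\<close> entries alone would exceed the budget \<open>R\<close>. Below \<open>\<eta>\<close> one has
  \<open>x \<le> x powr q * \<eta> powr (1 - q)\<close>. For \<open>q = 0\<close> the argument shows that the tail vanishes, because
  \<open>x powr 0\<close> takes only the values 0 and 1.\<close>

lemma powr_sparse_tail:
  fixes s :: "nat \<Rightarrow> real"
  assumes s: "\<And>i. i < m \<Longrightarrow> 0 \<le> s i" "\<And>i j. i \<le> j \<Longrightarrow> j < m \<Longrightarrow> s j \<le> s i"
    and R: "(\<Sum>i<m. s i powr q) \<le> R" and q: "0 \<le> q" "q \<le> 1" and \<eta>: "0 < \<eta>"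
    and r: "r = min (nat \<lfloor>R * \<eta> powr (- q)\<rfloor>) m"
  shows "(\<Sum>i=r..<m. s i) \<le> R * \<eta> powr (1 - q)"
proof -
  have R0: "0 \<le> R" using R sum_nonneg[of "{..<m}" "\<lambda>i. s i powr q"] by simp
  have le: "s i \<le> s i powr q * \<eta> powr (1 - q)" if i: "r \<le> i" "i < m" for i
  proof (cases "s i = 0")
    case False
    then have pos: "0 < s i" "s i \<le> s r" using s(1)[of i] s(2)[of r i] i by auto
    have "R * \<eta> powr (- q) < real (Suc r)" using r i by (auto simp: min_def split: if_splits) linarith+
    then have "R < real (Suc r) * \<eta> powr q" using \<eta> by (simp add: powr_minus field_simps)
    moreover have "real (Suc r) * s r powr q \<le> R"
    proof -
      have "(\<Sum>j<Suc r. s r powr q) \<le> (\<Sum>j<Suc r. s j powr q)"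
        using i pos q s by (intro sum_mono powr_mono2) auto
      also have "\<dots> \<le> (\<Sum>j<m. s j powr q)" using i by (intro sum_mono2) auto
      finally show ?thesis using R by simp
    qed
    ultimately have "s r powr q < \<eta> powr q"
      by (meson le_less_trans mult_less_cancel_left_pos of_nat_0_less_iff zero_less_Suc)
    then have "s r < \<eta>" using powr_mono2[of q \<eta> "s r"] \<eta> q by linarith
    then have "s i powr (1 - q) \<le> \<eta> powr (1 - q)" using pos q by (intro powr_mono2) auto
    moreover have "s i = s i powr q * s i powr (1 - q)" using pos by (simp add: powr_add[symmetric])
    ultimately show ?thesis by (metis mult_left_mono powr_ge_zero)
  qed simp
  have "(\<Sum>i=r..<m. s i) \<le> (\<Sum>i=r..<m. s i powr q * \<eta> powr (1 - q))" by (intro sum_mono) (auto intro: le)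
  also have "\<dots> = (\<Sum>i=r..<m. s i powr q) * \<eta> powr (1 - q)" by (simp add: sum_distrib_right)
  also have "\<dots> \<le> R * \<eta> powr (1 - q)"
    using sum_mono2[of "{..<m}" "{r..<m}" "\<lambda>i. s i powr q"] R
    by (intro mult_right_mono) (auto simp: subset_eq)
  finally show ?thesis .
qed

section \<open>The estimation error\<close>

lemma trace_transpose_mult: "trace (transpose A ** B) = A \<bullet> (B :: real^'p^'k)"
  by (simp add: trace_def transpose_def matrix_matrix_mult_def inner_vec_def) (rule sum.swap)

lemma obs_op_diff: "obs_op X (A - B) = obs_op X A - obs_op X B"
  by (simp add: obs_op_def trace_transpose_mult inner_diff_right vec_eq_iff)

lemma inner_obs_op: "e \<bullet> obs_op X A = obs_adj X e \<bullet> A"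
  by (simp add: obs_op_def trace_transpose_mult obs_adj_def inner_sum_left inner_vec_def[of e])

text \<open>Optimality bounds the quadratic term by the noise term plus the decrease in nuclear norm. The factor 2 in the
  condition on \<open>lam\<close> lets half of the penalty absorb the noise, which leaves the weights 3 and \<open>- 1\<close>.\<close>

lemma error_basic_inequality:
  fixes X :: "(real^'p^'k)^'n" and \<Theta>s \<Theta>hat :: "real^'p^'k"
  assumes svd: "is_svd \<Theta>s U s V" and r: "r \<le> min_dim \<Theta>s"
    and lam: "lam \<ge> 2 * op_norm (obs_adj X \<epsilon>) / real CARD('n)" "0 \<le> lam"
    and obj: "objective X (obs_op X \<Theta>s + \<epsilon>) lam \<Theta>hat \<le> objective X (obs_op X \<Theta>s + \<epsilon>) lam \<Theta>s"
    and \<Delta>: "\<Delta> = \<Theta>hat - \<Theta>s"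
  shows "1 / (2 * real CARD('n)) * (norm (obs_op X \<Delta>))\<^sup>2
      \<le> lam / 2 * (3 * nuclear_norm (\<Delta> - perp_proj r U V \<Delta>) - nuclear_norm (perp_proj r U V \<Delta>)
                      + 4 * (\<Sum>i=r..<min_dim \<Theta>s. s i))"
proof -
  let ?N = "real CARD('n)" and ?D2 = "perp_proj r U V \<Delta>" and ?G = "obs_adj X \<epsilon>"
  let ?D1 = "\<Delta> - ?D2"
  have N: "0 < ?N" by simp
  have op: "op_norm ?G / ?N \<le> lam / 2" using lam by (simp add: mult.commute)
  have "obs_op X \<Theta>s + \<epsilon> - obs_op X \<Theta>hat = \<epsilon> - obs_op X \<Delta>" by (simp add: \<Delta> obs_op_diff)
  then have "(norm (obs_op X \<Theta>s + \<epsilon> - obs_op X \<Theta>hat))\<^sup>2 = (norm (\<epsilon> - obs_op X \<Delta>))\<^sup>2"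
    by (rule arg_cong)
  also have "(norm (\<epsilon> - obs_op X \<Delta>))\<^sup>2 = (norm \<epsilon>)\<^sup>2 - 2 * (?G \<bullet> \<Delta>) + (norm (obs_op X \<Delta>))\<^sup>2"
    by (simp add: power2_norm_eq_inner inner_diff_left inner_diff_right
        inner_commute[of "obs_op X \<Delta>" \<epsilon>] inner_obs_op[symmetric])
  finally have "1 / (2 * ?N) * ((norm \<epsilon>)\<^sup>2 - 2 * (?G \<bullet> \<Delta>) + (norm (obs_op X \<Delta>))\<^sup>2) + lam * nuclear_norm \<Theta>hat
      \<le> 1 / (2 * ?N) * (norm \<epsilon>)\<^sup>2 + lam * nuclear_norm \<Theta>s"
    using obj by (simp add: objective_def)
  moreover have "1 / (2 * ?N) * ((norm \<epsilon>)\<^sup>2 - 2 * (?G \<bullet> \<Delta>) + (norm (obs_op X \<Delta>))\<^sup>2)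
      = 1 / (2 * ?N) * (norm \<epsilon>)\<^sup>2 - (?G \<bullet> \<Delta>) / ?N + 1 / (2 * ?N) * (norm (obs_op X \<Delta>))\<^sup>2"
    by (simp add: add_divide_distrib diff_divide_distrib)
  ultimately have basic: "1 / (2 * ?N) * (norm (obs_op X \<Delta>))\<^sup>2
      \<le> (?G \<bullet> \<Delta>) / ?N + lam * (nuclear_norm \<Theta>s - nuclear_norm \<Theta>hat)"
    by (simp add: right_diff_distrib)
  have G: "(?G \<bullet> B) / ?N \<le> lam / 2 * nuclear_norm B" for B
  proof -
    have "?G \<bullet> B \<le> op_norm ?G * nuclear_norm B"
      using abs_inner_le_nuclear_norm[OF norm_mult_vec_le_op_norm, of ?G B] by linarith
    then have "(?G \<bullet> B) / ?N \<le> op_norm ?G * nuclear_norm B / ?N" using N by (intro divide_right_mono) auto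
    also have "\<dots> = op_norm ?G / ?N * nuclear_norm B" by simp
    also have "\<dots> \<le> lam / 2 * nuclear_norm B"
      by (rule mult_right_mono[OF op nuclear_norm_nonneg])
    finally show ?thesis .
  qed
  have "(?G \<bullet> \<Delta>) / ?N = (?G \<bullet> ?D1) / ?N + (?G \<bullet> ?D2) / ?N"
    by (simp add: add_divide_distrib[symmetric] inner_add_right[symmetric])
  then have noise: "(?G \<bullet> \<Delta>) / ?N \<le> lam / 2 * (nuclear_norm ?D1 + nuclear_norm ?D2)"
    using G[of ?D1] G[of ?D2] unfolding distrib_left by linarith
  have "nuclear_norm \<Theta>s - nuclear_norm \<Theta>hat
      \<le> 2 * (\<Sum>i=r..<min_dim \<Theta>s. s i) + nuclear_norm ?D1 - nuclear_norm ?D2"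
    using nuclear_norm_add_ge[OF svd r, of \<Delta>] by (simp add: \<Delta>)
  then have penalty: "lam * (nuclear_norm \<Theta>s - nuclear_norm \<Theta>hat)
      \<le> lam * (2 * (\<Sum>i=r..<min_dim \<Theta>s. s i) + nuclear_norm ?D1 - nuclear_norm ?D2)"
    using lam(2) by (rule mult_left_mono)
  have weights: "lam / 2 * (3 * a - b + 4 * t) = lam / 2 * (a + b) + lam * (2 * t + a - b)" for a b t
    by (simp add: field_simps)
  show ?thesis unfolding weights using basic noise penalty by linarith
qed

theorem corollary2:
  fixes X :: "(real^'p^'k)^'n"
    and \<Theta>s \<Theta>hat :: "real^'p^'k"
    and y \<epsilon> :: "real^'n"
    and U :: "nat \<Rightarrow> real^'k" and s :: "nat \<Rightarrow> real" and V :: "nat \<Rightarrow> real^'p"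
    and q R\<^sub>q \<delta> lam \<kappa> :: real
  assumes q: "0 \<le> q" "q \<le> 1"
    and Rq: "R\<^sub>q > 0"
    and ball: "\<Theta>s \<in> schatten_ball q R\<^sub>q"
    and svd: "is_svd \<Theta>s U s V"
    and model: "y = obs_op X \<Theta>s + \<epsilon>"
    and \<delta>: "\<delta> \<ge> 0"
    and lam: "lam > 0" "lam \<ge> 2 * op_norm (obs_adj X \<epsilon>) / real CARD('n)"
    and \<kappa>: "0 < \<kappa>" "\<kappa> \<le> 1"
    and rsc: "rsc X \<kappa> (cone_set_real U V \<Theta>s (R\<^sub>q * lam powr (- q)) \<delta>)"
    and sol: "is_arg_min (objective X y lam) (\<lambda>_. True) \<Theta>hat"
  shows "norm (\<Theta>hat - \<Theta>s) \<le> max \<delta> (32 * sqrt R\<^sub>q * (lam / \<kappa>) powr (1 - q / 2))"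
proof (cases "norm (\<Theta>hat - \<Theta>s) \<le> \<delta>")
  case False
  define \<Delta> where "\<Delta> = \<Theta>hat - \<Theta>s"
  define T where "T = norm \<Delta>"
  define m where "m = min_dim \<Theta>s"
  define E where "E = 1 / (2 * real CARD('n)) * (norm (obs_op X \<Delta>))\<^sup>2"
  have U: "orthonormal_family m U" and V: "orthonormal_family m V"
    using svd by (auto simp: is_svd_def m_def)
  have obj: "objective X (obs_op X \<Theta>s + \<epsilon>) lam \<Theta>hat \<le> objective X (obs_op X \<Theta>s + \<epsilon>) lam \<Theta>s"
    using sol model by (auto simp: is_arg_min_def not_less)
  have basic: "E \<le> lam / 2 * (3 * nuclear_norm (\<Delta> - perp_proj r U V \<Delta>)
      - nuclear_norm (perp_proj r U V \<Delta>) + 4 * (\<Sum>i=r..<m. s i))" if "r \<le> m" for r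
    unfolding E_def m_def
    by (rule error_basic_inequality[OF svd _ lam(2) _ obj \<Delta>_def])
      (use that lam m_def in auto)
  \<comment> \<open>First cutoff, at the level \<open>lam\<close>: it serves only to verify membership in the cone.\<close>
  have curv: "\<kappa> * T\<^sup>2 \<le> E"
  proof -
    define r where "r = min (nat \<lfloor>R\<^sub>q * lam powr (- q)\<rfloor>) m"
    have "0 \<le> E" by (simp add: E_def)
    also have "E \<le> lam / 2 * (3 * nuclear_norm (\<Delta> - perp_proj r U V \<Delta>)
        - nuclear_norm (perp_proj r U V \<Delta>) + 4 * (\<Sum>i=r..<m. s i))"
      by (rule basic) (simp add: r_def)
    finally have "nuclear_norm (perp_proj r U V \<Delta>)
        \<le> 3 * nuclear_norm (\<Delta> - perp_proj r U V \<Delta>) + 4 * (\<Sum>i=r..<m. s i)"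
      using lam(1) by (simp add: zero_le_mult_iff)
    moreover have "(\<Sum>i=r..<m. s i) \<le> nuclear_norm (perp_proj r U V \<Theta>s)"
      unfolding m_def by (rule tail_le_nuclear_norm_perp_proj[OF svd])
    ultimately have "\<Delta> \<in> cone_set U V \<Theta>s r \<delta>" using False by (simp add: cone_set_def \<Delta>_def)
    then have "\<Delta> \<in> cone_set_real U V \<Theta>s (R\<^sub>q * lam powr (- q)) \<delta>"
      by (simp add: cone_set_real_def r_def m_def)
    then show ?thesis using rsc by (simp add: rsc_def E_def T_def)
  qed
  \<comment> \<open>Second cutoff, at the level \<open>lam / \<kappa>\<close>: here the rank term is at most a multiple of \<open>b * T\<close> and the
      tail term at most a multiple of \<open>b\<^sup>2\<close>.\<close>
  define \<eta> where "\<eta> = lam / \<kappa>"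
  have \<eta>: "0 < \<eta>" using lam \<kappa> by (simp add: \<eta>_def)
  define r where "r = min (nat \<lfloor>R\<^sub>q * \<eta> powr (- q)\<rfloor>) m"
  define b where "b = sqrt R\<^sub>q * \<eta> powr (1 - q / 2)"
  have rm: "r \<le> m" by (simp add: r_def)
  have b: "0 < b" using Rq \<eta> by (simp add: b_def)
  have T: "0 \<le> T" by (simp add: T_def)
  have "real r \<le> real (nat \<lfloor>R\<^sub>q * \<eta> powr (- q)\<rfloor>)" by (simp add: r_def)
  also have "\<dots> \<le> R\<^sub>q * \<eta> powr (- q)" using Rq by simp
  also have "\<dots> = (sqrt R\<^sub>q * \<eta> powr (- q / 2))\<^sup>2"
    using Rq powr_add[of \<eta> "- q / 2" "- q / 2"] by (simp add: power_mult_distrib power2_eq_square[of "\<eta> powr _"])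
  finally have "sqrt (real r) \<le> sqrt R\<^sub>q * \<eta> powr (- q / 2)"
    using Rq by (intro real_le_lsqrt) auto
  then have "\<eta> * sqrt (real r) \<le> \<eta> * (sqrt R\<^sub>q * \<eta> powr (- q / 2))" using \<eta> by simp
  also have "\<dots> = b"
    using \<eta> powr_add[of \<eta> 1 "- q / 2"] by (simp add: b_def algebra_simps)
  finally have rb: "\<eta> * sqrt (real r) \<le> b" .
  have sing: "(\<Sum>i<m. s i powr q) \<le> R\<^sub>q"
    using ball by (simp add: schatten_ball_def m_def is_svd_sing_val[OF svd])
  have tail: "(\<Sum>i=r..<m. s i) \<le> R\<^sub>q * \<eta> powr (1 - q)"
    by (rule powr_sparse_tail[OF _ _ sing q \<eta> r_def]) (use svd in \<open>auto simp: is_svd_def m_def\<close>)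
  have "\<eta> * (R\<^sub>q * \<eta> powr (1 - q)) = R\<^sub>q * \<eta> powr (2 - q)"
    using \<eta> powr_add[of \<eta> 1 "1 - q"] by simp
  also have "\<dots> = b\<^sup>2"
    using Rq by (simp add: b_def power_mult_distrib power2_eq_square[of "\<eta> powr _"] powr_add[symmetric])
  finally have tb: "\<eta> * (R\<^sub>q * \<eta> powr (1 - q)) = b\<^sup>2" .
  have D1: "nuclear_norm (\<Delta> - perp_proj r U V \<Delta>) \<le> 2 * sqrt (real r) * T"
    unfolding T_def using U V rm by (intro nuclear_norm_diff_perp_proj_le) (auto intro: orthonormal_family_mono)
  have "\<kappa> * T\<^sup>2 \<le> lam / 2 * (3 * nuclear_norm (\<Delta> - perp_proj r U V \<Delta>)
      - nuclear_norm (perp_proj r U V \<Delta>) + 4 * (\<Sum>i=r..<m. s i))"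
    using curv basic[OF rm] by linarith
  also have "\<dots> \<le> lam / 2 * (3 * (2 * sqrt (real r) * T) + 4 * (R\<^sub>q * \<eta> powr (1 - q)))"
    using lam(1) nuclear_norm_nonneg[of "perp_proj r U V \<Delta>"] D1 tail by (intro mult_left_mono) auto
  also have "\<dots> = \<kappa> * (3 * (\<eta> * sqrt (real r)) * T + 2 * (\<eta> * (R\<^sub>q * \<eta> powr (1 - q))))"
    using \<kappa> by (simp add: \<eta>_def field_simps)
  finally have "T\<^sup>2 \<le> 3 * (\<eta> * sqrt (real r)) * T + 2 * (\<eta> * (R\<^sub>q * \<eta> powr (1 - q)))"
    using \<kappa>(1) by simp
  also have "\<dots> \<le> 3 * b * T + 2 * b\<^sup>2"
    unfolding tb using rb T by (intro add_mono mult_right_mono) auto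
  finally have quad: "T\<^sup>2 \<le> 3 * b * T + 2 * b\<^sup>2" .
  have "T \<le> 4 * b"
  proof (rule ccontr)
    assume "\<not> T \<le> 4 * b"
    then have "4 * b < T" by simp
    then have "0 < (T - 4 * b) * (T + b)" using b T by (intro mult_pos_pos) auto
    moreover have "(T - 4 * b) * (T + b) = T\<^sup>2 - 3 * b * T - 4 * b\<^sup>2"
      by (simp add: algebra_simps power2_eq_square)
    ultimately show False using quad zero_le_power2[of b] by linarith
  qed
  then have "T \<le> 32 * b" using b by simp
  then show ?thesis by (simp add: T_def \<Delta>_def b_def \<eta>_def)
qed simp

end
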